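(* For every prime power $q\ge 2$ and every positive integer $n$, \[ \log_2 {n \brack 1}_q \;\le\; A(n,q) \;\le\; (q-1)(n-1)+1, \] where ${n \brack 1}_q=\frac{q^n-1}{q-1}$.
   Context: Let $q$ be a prime power and $V$ an $n$-dimensional vector space over $\mathrm{GF}(q)$. An unknown $1$-dimensional subspace $\mathbf{v}$ of $V$ is to be found using queries that are subspaces $U$ of $V$; the answer to query $U$ is YES if $\mathbf{v}\le U$ and NO otherwise. $A(n,q)$ is the minimum number of queries needed, in the worst case, to determine $\mathbf{v}$ in adaptive search (later queries may depend on the answers to earlier ones). ${n\brack 1}_q$ is the number of $1$-dimensional subspaces of $V$. *)

theory Defs
  imports Complex_Main "HOL-Library.Cardinality" "HOL-Number_Theory.Prime_Powers"
begin

text \<open>An adaptive search strategy: a node asks a query and continues in the left (YES) or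
  right (NO) subtree; a leaf announces the subspace that has been found.\<close>

datatype 'v strategy =
    Announce "'v set"
  | Ask "'v set" "'v strategy" "'v strategy"

primrec queries :: "'v strategy \<Rightarrow> 'v set set" where
  "queries (Announce W) = {}"
| "queries (Ask U t1 t2) = insert U (queries t1 \<union> queries t2)"

primrec outcome :: "'v strategy \<Rightarrow> 'v set \<Rightarrow> 'v set" where
  "outcome (Announce W) v = W"
| "outcome (Ask U t1 t2) v = (if v \<subseteq> U then outcome t1 v else outcome t2 v)"

primrec num_queries :: "'v strategy \<Rightarrow> 'v set \<Rightarrow> nat" where
  "num_queries (Announce W) v = 0"
| "num_queries (Ask U t1 t2) v = Suc (if v \<subseteq> U then num_queries t1 v else num_queries t2 v)"

definition one_dim_subspaces ::
    "('f::field \<Rightarrow> 'v::ab_group_add \<Rightarrow> 'v) \<Rightarrow> 'v set \<Rightarrow> 'v set set" where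
  "one_dim_subspaces scale V =
     {v. module.subspace scale v \<and> v \<subseteq> V \<and> vector_space.dim scale v = 1}"

definition determines ::
    "('f::field \<Rightarrow> 'v::ab_group_add \<Rightarrow> 'v) \<Rightarrow> 'v set \<Rightarrow> 'v strategy \<Rightarrow> bool" where
  "determines scale V t \<longleftrightarrow>
     (\<forall>U \<in> queries t. module.subspace scale U \<and> U \<subseteq> V) \<and>
     (\<forall>v \<in> one_dim_subspaces scale V. outcome t v = v)"

text \<open>The number \<open>A(n,q)\<close>, for an \<open>n\<close>-dimensional space \<open>V\<close> over a field with \<open>q\<close> elements.\<close>

definition adaptive_search_number ::
    "('f::field \<Rightarrow> 'v::ab_group_add \<Rightarrow> 'v) \<Rightarrow> 'v set \<Rightarrow> nat" where
  "adaptive_search_number scale V =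
     (LEAST k. \<exists>t. determines scale V t \<and>
        (\<forall>v \<in> one_dim_subspaces scale V. num_queries t v \<le> k))"

end

theory Submission imports Defs begin

text \<open>
  Lower bound: a decision tree whose branches have length at most \<open>k\<close> has at most \<open>2 ^ k\<close> outcomes.

  Upper bound: ask a hyperplane \<open>H\<close> of \<open>V\<close>. On YES, continue inside \<open>H\<close>. On NO, the unknown line has
  a unique generator in an affine translate \<open>b + H\<close>, whose \<open>n - 1\<close> remaining coordinates are found
  one after the other with \<open>q - 1\<close> queries each: to test whether the coordinate along \<open>e\<close> is \<open>c\<close>, ask
  the span of \<open>b + c e\<close> and of the basis vectors not treated yet.
\<close>

section \<open>Counting the outcomes of a decision tree\<close>

lemma card_le_two_power_if_identified:
  assumes "\<And>v. v \<in> S \<Longrightarrow> outcome t v = v" "\<And>v. v \<in> S \<Longrightarrow> num_queries t v \<le> k" "finite S"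
  shows "card S \<le> 2 ^ k"
  using assms
proof (induction t arbitrary: S k)
  case (Announce W)
  then have "S \<subseteq> {W}" by auto
  then have "card S \<le> 1" using card_mono[of "{W}" S] by simp
  also have "1 \<le> (2::nat) ^ k" by simp
  finally show ?case .
next
  case (Ask U t1 t2)
  show ?case
  proof (cases "S = {}")
    case False
    \<comment> \<open>A member of \<open>S\<close> already costs the root query, so \<open>k\<close>
      is positive. For empty \<open>S\<close> the value 0 is possible, hence the case split.\<close>
    then obtain j where k: "k = Suc j"
      using Ask.prems(2) by (cases k) auto
    let ?Y = "{v \<in> S. v \<subseteq> U}" and ?N = "{v \<in> S. \<not> v \<subseteq> U}"
    have "outcome t1 v = v" "num_queries t1 v \<le> j" if "v \<in> ?Y" for v
      using that Ask.prems(1,2)[of v] k by auto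
    then have Y: "card ?Y \<le> 2 ^ j"
      using Ask.IH(1)[of ?Y j] Ask.prems(3) by simp
    have "outcome t2 v = v" "num_queries t2 v \<le> j" if "v \<in> ?N" for v
      using that Ask.prems(1,2)[of v] k by auto
    then have N: "card ?N \<le> 2 ^ j"
      using Ask.IH(2)[of ?N j] Ask.prems(3) by simp
    have "card S = card (?Y \<union> ?N)" by (rule arg_cong[where f = card]) auto
    also have "\<dots> \<le> card ?Y + card ?N" by (rule card_Un_le)
    finally show ?thesis using Y N k by simp
  qed simp
qed

text \<open>Lines are represented by generators, so that \<open>X\<close> may be an affine translate
  as well as a punctured subspace. \<open>V\<close> stays the ambient space while the recursion
  shrinks \<open>X\<close>.\<close>

definition identifies ::
    "('f::field \<Rightarrow> 'v::ab_group_add \<Rightarrow> 'v) \<Rightarrow> 'v set \<Rightarrow> nat \<Rightarrow> 'v set \<Rightarrow> 'v strategy \<Rightarrow> bool" where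
  "identifies scale V k X t \<longleftrightarrow> (\<forall>U \<in> queries t. module.subspace scale U \<and> U \<subseteq> V) \<and>
     (\<forall>x \<in> X. outcome t (module.span scale {x}) = module.span scale {x} \<and>
        num_queries t (module.span scale {x}) \<le> k)"

context vector_space
begin

section \<open>Counting vectors and lines over a finite field\<close>

lemma mem_span_if_scale_mem:
  assumes "scale k x \<in> span B" "k \<noteq> 0"
  shows "x \<in> span B"
  using span_scale[OF assms(1), of "inverse k"] assms(2) by simp

text \<open>Each new basis vector \<open>b\<close> multiplies the size by the order of the field,
  because the coefficient at \<open>b\<close> and the remainder in \<open>span B\<close> are
  unique.\<close>

lemma card_span_independent:
  assumes "finite B" "independent B" "finite (UNIV :: 'a set)"
  shows "finite (span B) \<and> card (span B) = CARD('a) ^ card B"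
  using assms(1,2)
proof (induction B)
  case (insert b B)
  then have b: "b \<notin> span B" and IH: "finite (span B)" "card (span B) = CARD('a) ^ card B"
    by (auto simp: independent_insert)
  let ?f = "\<lambda>(k, w). scale k b + w"
  have inj: "inj_on ?f (UNIV \<times> span B)"
  proof (clarsimp simp: inj_on_def)
    fix k w l z
    assume w: "w \<in> span B" and z: "z \<in> span B" and eq: "scale k b + w = scale l b + z"
    have "scale (k - l) b = z - w" using eq by (simp add: scale_left_diff_distrib algebra_simps)
    then have "scale (k - l) b \<in> span B" using w z span_diff by simp
    then have "k = l" using b mem_span_if_scale_mem[of "k - l" b] by auto
    then show "k = l \<and> w = z" using eq by simp
  qed
  have "span (insert b B) = ?f ` (UNIV \<times> span B)"
  proof (intro equalityI subsetI)
    fix x assume "x \<in> span (insert b B)"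
    then obtain k where "x - scale k b \<in> span B" by (auto simp: span_breakdown_eq)
    then show "x \<in> ?f ` (UNIV \<times> span B)"
      by (intro image_eqI[of _ _ "(k, x - scale k b)"]) auto
  next
    fix x assume "x \<in> ?f ` (UNIV \<times> span B)"
    then obtain k w where "x = scale k b + w" "w \<in> span B" by auto
    then show "x \<in> span (insert b B)"
      unfolding span_breakdown_eq by (intro exI[of _ k]) simp
  qed
  then show ?case
    using card_image[OF inj] IH insert.hyps assms(3) by (simp add: card_cartesian_product)
qed simp

lemma one_dim_subspaces_eq:
  assumes "subspace V"
  shows "one_dim_subspaces scale V = (\<lambda>x. span {x}) ` (V - {0})"
proof (intro equalityI subsetI)
  fix L assume "L \<in> one_dim_subspaces scale V"
  then have L: "subspace L" "L \<subseteq> V" "dim L = 1" by (auto simp: one_dim_subspaces_def)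
  obtain B where B: "B \<subseteq> L" "independent B" "L \<subseteq> span B" "card B = dim L"
    by (rule basis_exists)
  then obtain x where x: "B = {x}" using L by (auto simp: card_1_singleton_iff)
  then have "L = span {x}" "x \<noteq> 0" using B L span_minimal[of B L] by auto
  then show "L \<in> (\<lambda>x. span {x}) ` (V - {0})" using x B L by auto
next
  fix L assume "L \<in> (\<lambda>x. span {x}) ` (V - {0})"
  then obtain x where x: "L = span {x}" "x \<in> V" "x \<noteq> 0" by auto
  then have "dim L = 1" using dim_eq_card_independent[of "{x}"] by simp
  then show "L \<in> one_dim_subspaces scale V"
    using x assms span_minimal[of "{x}" V] by (auto simp: one_dim_subspaces_def)
qed

lemma span_singleton_eqI:
  assumes "y \<in> span {x}" "y \<noteq> 0"
  shows "span {y} = span {x}"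
proof -
  obtain k where k: "y = scale k x" using assms by (auto simp: span_singleton)
  then have "k \<noteq> 0" using assms by auto
  then have "x = scale (inverse k) y" using k by simp
  then have "x \<in> span {y}" by (metis span_base span_scale singletonI)
  then show ?thesis using assms span_minimal[of "{y}" "span {x}"] span_minimal[of "{x}" "span {y}"]
    by auto
qed

text \<open>The lines with 0 removed partition the nonzero vectors of \<open>V\<close>, and over a
  field of order q each such part has q - 1 elements.\<close>

lemma card_one_dim_subspaces:
  assumes fin: "finite (UNIV :: 'a set)" and V: "subspace V" "finite V"
  shows "(CARD('a) - 1) * card (one_dim_subspaces scale V) = card V - 1"
proof -
  let ?C = "one_dim_subspaces scale V"
  let ?g = "\<lambda>L. L - {0}"
  have C: "?C = (\<lambda>x. span {x}) ` (V - {0})" by (rule one_dim_subspaces_eq[OF V(1)])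
  have "(CARD('a) - 1) * card (?g ` ?C) = card (\<Union> (?g ` ?C))"
  proof (rule card_partition)
    show "finite (?g ` ?C)" using C V by simp
    show "finite (\<Union> (?g ` ?C))"
      by (rule finite_subset[OF _ V(2)]) (auto simp: one_dim_subspaces_def)
    show "card c = CARD('a) - 1" if c: "c \<in> ?g ` ?C" for c
    proof -
      obtain x where x: "c = span {x} - {0}" "x \<noteq> 0" using c unfolding C by blast
      then show ?thesis
        using card_span_independent[of "{x}"] fin by (simp add: span_zero)
    qed
    show "c \<inter> d = {}" if cd: "c \<in> ?g ` ?C" "d \<in> ?g ` ?C" and neq: "c \<noteq> d" for c d
    proof -
      obtain x y where "c = span {x} - {0}" "d = span {y} - {0}" using cd unfolding C by blast
      then show ?thesis using neq span_singleton_eqI by blast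
    qed
  qed
  \<comment> \<open>Every line contains 0, so putting it back recovers the line.\<close>
  moreover have "inj_on ?g ?C"
    by (rule inj_onI) (metis C image_iff insert_Diff span_zero)
  moreover have "\<Union> (?g ` ?C) = V - {0}"
    using C span_base[of _ "{_}"] by (auto simp: one_dim_subspaces_def)
  ultimately show ?thesis
    using subspace_0[OF V(1)] by (simp add: card_image)
qed

section \<open>Construction of the search strategy\<close>

lemma span_singleton_subset_span_iff: "span {x} \<subseteq> span B \<longleftrightarrow> x \<in> span B"
  using span_minimal[of "{x}" "span B"] span_base[of x "{x}"] by auto

text \<open>A subspace contains a line exactly when it contains a generator, so a query splits the
  generators by membership.\<close>

lemma identifies_Ask:
  assumes "identifies scale V k X t1" "identifies scale V l Y t2" "subspace U" "U \<subseteq> V"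
    and "\<And>x. x \<in> Z \<Longrightarrow> x \<in> U \<Longrightarrow> x \<in> X" "\<And>x. x \<in> Z \<Longrightarrow> x \<notin> U \<Longrightarrow> x \<in> Y" "k \<le> m" "l \<le> m"
  shows "identifies scale V (Suc m) Z (Ask U t1 t2)"
proof -
  have U: "span {x} \<subseteq> U \<longleftrightarrow> x \<in> U" for x
    using assms(3) span_singleton_subset_span_iff[of x U] by (simp add: span_eq_iff[THEN iffD2])
  let ?t = "Ask U t1 t2"
  have "outcome ?t (span {x}) = span {x} \<and> num_queries ?t (span {x}) \<le> Suc m" if "x \<in> Z" for x
  proof (cases "x \<in> U")
    case True
    then have "x \<in> X" using that assms(5) by blast
    then show ?thesis using True U assms(1,7) by (auto simp: identifies_def)
  next
    case False
    then have "x \<in> Y" using that assms(6) by blast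
    then show ?thesis using False U assms(2,8) by (auto simp: identifies_def)
  qed
  moreover have "\<forall>W \<in> queries ?t. subspace W \<and> W \<subseteq> V"
    using assms(1-4) by (auto simp: identifies_def)
  ultimately show ?thesis unfolding identifies_def by blast
qed

text \<open>Independence of \<open>a\<close> from \<open>B\<close> makes distinct vectors of the
  translate span distinct lines. The base point varies in the induction: once the coordinate
  \<open>c\<close> along \<open>e\<close> is known, it becomes \<open>a + scale c e\<close>.\<close>

lemma identifies_affine:
  assumes "finite B" "independent (insert a B)" "a \<notin> B" "span (insert a B) \<subseteq> V"
    and fin: "finite (UNIV :: 'a set)"
  shows "\<exists>t. identifies scale V ((CARD('a) - 1) * card B) {x. x - a \<in> span B} t"
  using assms(1-4)
proof (induction B arbitrary: a)
  case empty
  then show ?case by (intro exI[of _ "Announce (span {a})"]) (auto simp: identifies_def)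
next
  case (insert e B)
  let ?q = "CARD('a)"
  have ind: "independent (insert a (insert e B))" "independent (insert e B)" "e \<notin> span B"
    "a \<notin> span (insert e B)"
    using insert by (auto simp: independent_insert)
  have indB: "independent B" using ind(2) by (rule independent_mono) auto
  \<comment> \<open>The induction hypothesis needs the new base point to be independent of
    \<open>B\<close>.\<close>
  have point_notin: "a + scale c e \<notin> span B" for c
  proof
    assume "a + scale c e \<in> span B"
    then have "a + scale c e \<in> span (insert e B)" using span_mono[of B "insert e B"] by blast
    then have "a + scale c e - scale c e \<in> span (insert e B)"
      by (rule span_diff) (auto intro: span_scale span_base)
    then show False using ind by simp
  qed
  have sub: "span (insert (a + scale c e) B) \<subseteq> V" for c
  proof -
    have "a + scale c e \<in> span (insert a (insert e B))"
      by (intro span_add span_scale span_base) auto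
    then have "span (insert (a + scale c e) B) \<subseteq> span (insert a (insert e B))"
      by (intro span_minimal) (auto intro: span_base)
    then show ?thesis using insert.prems by auto
  qed
  have point: "\<exists>t. identifies scale V ((?q - 1) * card B) {x. x - (a + scale c e) \<in> span B} t" for c
    using insert.IH[OF independent_insertI[OF point_notin indB] _ sub] point_notin span_base by blast
  text \<open>Comparing coefficients at \<open>a\<close>: a vector in the query and in some slice is \<open>1\<close> times \<open>a + c e\<close> modulo \<open>span B\<close>.\<close>
  have separate: "x - (a + scale c e) \<in> span B"
    if x: "x \<in> span (insert (a + scale c e) B)" "x - (a + scale d e) \<in> span B" for x c d
  proof -
    obtain k where k: "x - scale k (a + scale c e) \<in> span B" using x by (auto simp: span_breakdown_eq)
    have "(x - (a + scale d e)) - (x - scale k (a + scale c e)) \<in> span B"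
      using x(2) k by (rule span_diff)
    then have r: "scale (k - 1) a + scale (k * c - d) e \<in> span B"
      by (simp add: algebra_simps)
    then have "scale (k - 1) a + scale (k * c - d) e - scale (k * c - d) e \<in> span (insert e B)"
      using span_mono[of B "insert e B"] by (intro span_diff[OF _ span_scale[OF span_base]]) auto
    then have "scale (k - 1) a \<in> span (insert e B)" by simp
    then have "k = 1" using ind mem_span_if_scale_mem[of "k - 1" a] by auto
    then show ?thesis using k by simp
  qed
  \<comment> \<open>\<open>C\<close> is the set of values still possible for the coordinate along
    \<open>e\<close>. Each query tests one value, and the last remaining one needs no test, hence
    \<open>card C - 1\<close>.\<close>
  have slices: "\<exists>t. identifies scale V (card C - 1 + (?q - 1) * card B)
      {x. \<exists>c\<in>C. x - (a + scale c e) \<in> span B} t" if "finite C" "C \<noteq> {}" for C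
    using that
  proof (induction C rule: finite_ne_induct)
    case (singleton c)
    then show ?case using point[of c] by simp
  next
    case (insert c C)
    obtain t1 where t1: "identifies scale V ((?q - 1) * card B) {x. x - (a + scale c e) \<in> span B} t1"
      using point by blast
    obtain t2 where t2: "identifies scale V (card C - 1 + (?q - 1) * card B)
      {x. \<exists>c\<in>C. x - (a + scale c e) \<in> span B} t2" using insert.IH by blast
    have in_query: "x \<in> span (insert (a + scale c e) B)" if "x - (a + scale c e) \<in> span B" for x
      using that unfolding span_insert by (auto intro: exI[of _ 1])
    \<comment> \<open>On YES, \<open>separate\<close> puts the vector into the slice of
      \<open>c\<close>; on NO, \<open>in_query\<close> excludes that slice and leaves those of
      \<open>C\<close>.\<close>
    have "identifies scale V (Suc (card C - 1 + (?q - 1) * card B))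
      {x. \<exists>c\<in>insert c C. x - (a + scale c e) \<in> span B}
      (Ask (span (insert (a + scale c e) B)) t1 t2)"
      by (rule identifies_Ask[OF t1 t2 subspace_span sub]) (use separate in_query in \<open>blast | simp\<close>)+
    moreover have "Suc (card C - 1) = card (insert c C) - 1"
      using insert.hyps by (simp add: card_gt_0_iff)
    ultimately show ?case by (metis add_Suc)
  qed
  \<comment> \<open>The slices over all field elements fill the whole translate, so
    \<open>C = UNIV\<close> costs q - 1 queries for this coordinate.\<close>
  have "{x. \<exists>c\<in>UNIV. x - (a + scale c e) \<in> span B} = {x. x - a \<in> span (insert e B)}"
    by (simp add: span_insert diff_diff_eq)
  moreover have "?q - 1 + (?q - 1) * card B = (?q - 1) * card (insert e B)"
    using insert.hyps by simp
  ultimately show ?case using slices[of UNIV] fin by simp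
qed

text \<open>The NO branch of the hyperplane query is the worst case, so the bound is that of the
  affine search plus one. The conditional covers the zero space, which has no lines and needs no
  query.\<close>

lemma identifies_linear:
  assumes "finite B" "independent B" "span B \<subseteq> V" and fin: "finite (UNIV :: 'a set)"
  shows "\<exists>t. identifies scale V ((CARD('a) - 1) * (card B - 1) + (if B = {} then 0 else 1)) (span B - {0}) t"
  using assms(1-3)
proof (induction B)
  case empty
  show ?case by (intro exI[of _ "Announce {}"]) (simp add: identifies_def)
next
  case (insert b B)
  let ?q = "CARD('a)"
  have b: "b \<notin> span B" "independent B" using insert by (auto simp: independent_insert)
  have sub: "span B \<subseteq> V" using insert.prems span_mono[of B "insert b B"] by auto
  obtain t1 where t1: "identifies scale V ((?q - 1) * (card B - 1) + (if B = {} then 0 else 1))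
      (span B - {0}) t1"
    using insert.IH b sub by blast
  obtain t2 where t2: "identifies scale V ((?q - 1) * card B) {x. x - b \<in> span B} t2"
    using identifies_affine[of B b V] insert fin by blast
  let ?N = "{x \<in> span (insert b B). x \<notin> span B}"
  \<comment> \<open>Dividing by the coefficient at \<open>b\<close>, nonzero outside
    \<open>span B\<close>, gives a generator in the translate.\<close>
  have norm: "\<exists>y. y - b \<in> span B \<and> span {x} = span {y}" if x: "x \<in> ?N" for x
  proof -
    obtain k where k: "x - scale k b \<in> span B" using x by (auto simp: span_breakdown_eq)
    then have k0: "k \<noteq> 0" using x by auto
    have "scale (inverse k) (x - scale k b) \<in> span B" using k by (rule span_scale)
    then have "scale (inverse k) x - b \<in> span B"
      using k0 by (simp add: scale_right_diff_distrib)
    moreover have "span {scale (inverse k) x} = span {x}"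
      using x k0 span_zero by (intro span_singleton_eqI) (auto intro: span_scale span_base)
    ultimately show ?thesis by metis
  qed
  \<comment> \<open>\<open>identifies\<close> sees a vector only through its span, so
    \<open>x\<close> may be replaced by its normalized generator.\<close>
  then have t2': "identifies scale V ((?q - 1) * card B) ?N t2"
    using t2 unfolding identifies_def by (smt (verit, best) mem_Collect_eq)
  \<comment> \<open>As 0 and 1 differ, q - 1 is at least 1. This absorbs the extra query in the YES
    bound, which therefore stays below the NO bound.\<close>
  have "?q \<ge> 2"
    using card_mono[OF fin, of "{0, 1}"] by simp
  then have le: "(?q - 1) * (card B - 1) + (if B = {} then 0 else 1) \<le> (?q - 1) * card B"
    using insert.hyps by (cases "card B") auto
  have "identifies scale V (Suc ((?q - 1) * card B)) (span (insert b B) - {0}) (Ask (span B) t1 t2)"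
    by (rule identifies_Ask[OF t1 t2' subspace_span sub _ _ le]) auto
  then show ?case using insert.hyps by auto
qed

end

theorem theorem1p3:
  fixes scale :: "'f::{field,finite} \<Rightarrow> 'v::ab_group_add \<Rightarrow> 'v"
    and V :: "'v set" and q n :: nat
  assumes "vector_space scale"
    and "primepow q" and "CARD('f) = q"
    and "module.subspace scale V"
    and "n \<ge> 1" and "vector_space.dim scale V = n"
  shows "real (card (one_dim_subspaces scale V)) = (real q ^ n - 1) / (real q - 1)
    \<and> log 2 (real (card (one_dim_subspaces scale V)))
        \<le> real (adaptive_search_number scale V)
    \<and> real (adaptive_search_number scale V) \<le> (real q - 1) * (real n - 1) + 1"
proof -
  interpret vector_space scale by fact
  let ?S = "one_dim_subspaces scale V"
  have q2: "q \<ge> 2" using primepow_gt_Suc_0[OF assms(2)] by simp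
  obtain B where B: "B \<subseteq> V" "independent B" "V \<subseteq> span B" "card B = n"
    using basis_exists[of V] assms(6) by metis
  \<comment> \<open>An infinite set has \<open>card\<close> 0, which \<open>n \<ge> 1\<close>
    excludes.\<close>
  have finB: "finite B" using B(4) assms(5) card.infinite by fastforce
  have V: "V = span B" using B span_minimal[OF B(1) assms(4)] by auto
  have cardV: "finite V" "card V = q ^ n"
    using card_span_independent[OF finB B(2)] V B(4) assms(3) by auto
  have S: "?S = (\<lambda>x. span {x}) ` (V - {0})" using one_dim_subspaces_eq assms(4) by blast
  have "(q - 1) * card ?S = q ^ n - 1"
    using card_one_dim_subspaces[OF _ assms(4)] cardV assms(3) by simp
  then have "real ((q - 1) * card ?S) = real (q ^ n - 1)" by simp
  then have "(real q - 1) * real (card ?S) = real q ^ n - 1"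
    using q2 by (simp add: of_nat_diff)
  then have count: "real (card ?S) = (real q ^ n - 1) / (real q - 1)"
    using q2 by (simp add: field_simps)
  let ?P = "\<lambda>k. \<exists>t. determines scale V t \<and> (\<forall>v \<in> ?S. num_queries t v \<le> k)"
  have "B \<noteq> {}" using B(4) assms(5) by auto
  then obtain t where "identifies scale V ((q - 1) * (n - 1) + 1) (V - {0}) t"
    using identifies_linear[OF finB B(2), of V] V B(4) assms(3) by auto
  then have P: "?P ((q - 1) * (n - 1) + 1)"
    by (intro exI[of _ t]) (auto simp: identifies_def determines_def S)
  have "adaptive_search_number scale V \<le> (q - 1) * (n - 1) + 1"
    unfolding adaptive_search_number_def by (rule Least_le) (rule P)
  then have "real (adaptive_search_number scale V) \<le> real ((q - 1) * (n - 1) + 1)"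
    by (simp only: of_nat_le_iff)
  then have upper: "real (adaptive_search_number scale V) \<le> (real q - 1) * (real n - 1) + 1"
    using q2 assms(5) by (simp add: of_nat_diff)
  \<comment> \<open>The strategy just built shows that some bound is admissible, so the least one is
    attained, and the counting bound applies to a strategy attaining it.\<close>
  have "?P (adaptive_search_number scale V)"
    unfolding adaptive_search_number_def by (rule LeastI) (rule P)
  then have "card ?S \<le> 2 ^ adaptive_search_number scale V"
    using card_le_two_power_if_identified[of ?S] cardV(1) S
    unfolding determines_def by (metis finite_Diff finite_imageI)
  then have "real (card ?S) \<le> 2 ^ adaptive_search_number scale V"
    by (metis of_nat_le_iff of_nat_numeral of_nat_power)
  \<comment> \<open>Positivity is needed to pass to the logarithm.\<close>
  moreover have "real (card ?S) > 0"
    using count q2 assms(5) by (simp add: one_less_power)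
  ultimately have "log 2 (real (card ?S)) \<le> real (adaptive_search_number scale V)"
    by (simp add: log_le_iff powr_realpow)
  then show ?thesis using count upper by simp
qed

end
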